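(* Let $T$ be a compact domain and let $K:T\times T\to\mathbb{R}$ be a continuous symmetric strictly positive definite kernel. Let $X=\{x_1,\ldots,x_n\}\subseteq T$ be a set of $n$ distinct points and $V_X:=\operatorname{span}\{K(\cdot,x_1),\ldots,K(\cdot,x_n)\}$. Let $H=\{h_1,\ldots,h_N\}\subseteq T$ be a set of $N$ distinct points and $V_H:=\operatorname{span}\{K(\cdot,h_1),\ldots,K(\cdot,h_N)\}$. Let $\sigma:H\to\{-1,+1\}$ be a sign function and put $\sigma_k:=\sigma(h_k)$. Then $(H,\sigma)$ is an $H$-set for $V_X$ if and only if there is a nonzero function $f\in V_H$ that vanishes on $X$ and whose coefficients in the basis $K(\cdot,h_1),\ldots,K(\cdot,h_N)$ of $V_H$ have signs given by $\sigma$, i.e. $$f=\sum_{k=1}^N w_k\sigma_k K(\cdot,h_k)\quad\text{with } w_k\ge 0 \text{ for all } 1\le k\le N$$ (so a zero coefficient is compatible with either sign).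
   Context: A symmetric kernel $K:T\times T\to\mathbb{R}$ is strictly positive definite if for every finite set of distinct points $y_1,\ldots,y_m\in T$ the matrix $(K(y_i,y_j))_{1\le i,j\le m}$ is positive definite. Definition ($H$-set). Let $V$ be a linear subspace of the space $C(T)$ of continuous real-valued functions on $T$. An $H$-set for $V$ consists of a subset $H\subseteq T$ and a sign function $\sigma:H\to\{-1,+1\}$ such that there is no $v\in V$ with $v(h)\sigma(h)<0$ for all $h\in H$. *)

theory Defs
  imports "HOL-Analysis.Analysis" "HOL-Library.Function_Algebras"
begin

text \<open>Pointwise real vector space structure on functions, so that the library's
  \<^const>\<open>span\<close> and \<^const>\<open>subspace\<close> apply to function spaces. Addition and zero come from
  \<^theory>\<open>HOL-Library.Function_Algebras\<close>.\<close>

instantiation "fun" :: (type, real_vector) real_vector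
begin

definition scaleR_fun :: "real \<Rightarrow> ('a \<Rightarrow> 'b) \<Rightarrow> 'a \<Rightarrow> 'b" where
  "scaleR_fun c f = (\<lambda>t. c *\<^sub>R f t)"

instance
  by standard (simp_all add: scaleR_fun_def fun_eq_iff scaleR_add_right scaleR_add_left)

end

text \<open>A function on \<open>T\<close> is represented by its extension by \<open>0\<close> to the whole type. Thus equality
  of representatives (in particular being equal to \<open>0\<close>) is equality on \<open>T\<close>.\<close>

definition C_space :: "'a::topological_space set \<Rightarrow> ('a \<Rightarrow> real) set" where
  "C_space T = {f. continuous_on T f \<and> (\<forall>t. t \<notin> T \<longrightarrow> f t = 0)}"

definition positive_definite_matrix :: "nat \<Rightarrow> (nat \<Rightarrow> nat \<Rightarrow> real) \<Rightarrow> bool" where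
  "positive_definite_matrix m A \<longleftrightarrow>
     (\<forall>i\<in>{1..m}. \<forall>j\<in>{1..m}. A i j = A j i) \<and>
     (\<forall>c :: nat \<Rightarrow> real. (\<exists>i\<in>{1..m}. c i \<noteq> 0) \<longrightarrow> (\<Sum>i=1..m. \<Sum>j=1..m. c i * A i j * c j) > 0)"

definition symmetric_kernel :: "'a set \<Rightarrow> ('a \<Rightarrow> 'a \<Rightarrow> real) \<Rightarrow> bool" where
  "symmetric_kernel T K \<longleftrightarrow> (\<forall>s\<in>T. \<forall>t\<in>T. K s t = K t s)"

definition strictly_positive_definite :: "'a set \<Rightarrow> ('a \<Rightarrow> 'a \<Rightarrow> real) \<Rightarrow> bool" where
  "strictly_positive_definite T K \<longleftrightarrow>
     (\<forall>m (y :: nat \<Rightarrow> 'a). y ` {1..m} \<subseteq> T \<and> inj_on y {1..m} \<longrightarrow>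
        positive_definite_matrix m (\<lambda>i j. K (y i) (y j)))"

text \<open>The function \<open>K(\<cdot>, y)\<close> on \<open>T\<close>, extended by \<open>0\<close>.\<close>

definition kernel_section :: "'a set \<Rightarrow> ('a \<Rightarrow> 'a \<Rightarrow> real) \<Rightarrow> 'a \<Rightarrow> ('a \<Rightarrow> real)" where
  "kernel_section T K y = (\<lambda>t. if t \<in> T then K t y else 0)"

definition kernel_span :: "'a set \<Rightarrow> ('a \<Rightarrow> 'a \<Rightarrow> real) \<Rightarrow> 'a set \<Rightarrow> ('a \<Rightarrow> real) set" where
  "kernel_span T K Y = span (kernel_section T K ` Y)"

text \<open>Only the values of \<open>\<sigma>\<close> on \<open>H\<close> matter.\<close>

definition is_H_set ::
  "'a::topological_space set \<Rightarrow> ('a \<Rightarrow> real) set \<Rightarrow> 'a set \<Rightarrow> ('a \<Rightarrow> real) \<Rightarrow> bool" where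
  "is_H_set T V H \<sigma> \<longleftrightarrow>
     subspace V \<and> V \<subseteq> C_space T \<and>
     H \<subseteq> T \<and> \<sigma> ` H \<subseteq> {-1, 1} \<and>
     \<not> (\<exists>v\<in>V. \<forall>h\<in>H. v h * \<sigma> h < 0)"

end

theory Submission
  imports Defs
begin

text \<open>Let \<open>w\<close> be nonnegative and nonzero. By symmetry of \<open>K\<close>, the function
  \<open>\<Sum>k. w\<^sub>k \<sigma>\<^sub>k K(\<cdot>, h\<^sub>k)\<close> vanishes on \<open>X\<close> if and only if the functional
  \<open>v \<mapsto> \<Sum>k. w\<^sub>k \<sigma>\<^sub>k v(h\<^sub>k)\<close> vanishes on \<open>V\<^sub>X\<close>, and by strict positive definiteness this function
  is not zero. The theorem is thus Gordan's alternative for the functionals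
  \<open>v \<mapsto> \<sigma>\<^sub>k v(h\<^sub>k)\<close> on \<open>V\<^sub>X\<close>, which is proved by induction on the number of functionals,
  by restricting them to the kernel of one of them.\<close>

text \<open>As \<open>e\<close> tends to 0 from the right, \<open>a k + e * b k\<close> tends to
  \<open>a k < 0\<close>, and finitely many eventual conditions hold simultaneously.\<close>

lemma exists_perturbation_negative:
  fixes a b :: "'i \<Rightarrow> real"
  assumes "finite I" and "\<And>k. k \<in> I \<Longrightarrow> a k < 0"
  shows "\<exists>e>0. \<forall>k\<in>I. a k + e * b k < 0"
proof -
  have "\<forall>\<^sub>F e in at_right 0. a k + e * b k < 0" if "k \<in> I" for k
  proof (rule order_tendstoD(2))
    show "((\<lambda>e. a k + e * b k) \<longlongrightarrow> a k + 0 * b k) (at_right 0)"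
      by (intro tendsto_intros)
  qed (use assms(2) that in simp)
  then have "\<forall>\<^sub>F e in at_right (0::real). 0 < e \<and> (\<forall>k\<in>I. a k + e * b k < 0)"
    using assms(1)
    by (intro eventually_conj eventually_at_right_less) (simp add: eventually_ball_finite)
  then show ?thesis
    using eventually_happens'[of "at_right (0::real)"] by auto
qed

text \<open>All terms are nonpositive and one is strictly negative. This is the easy half of
  Gordan's alternative; it also fixes the sign of a multiplier in the proof of the other
  half.\<close>

lemma sum_neg_weighted:
  fixes w a :: "'i \<Rightarrow> real"
  assumes "finite I" and "\<forall>k\<in>I. w k \<ge> 0" and "\<exists>k\<in>I. w k \<noteq> 0" and "\<forall>k\<in>I. a k < 0"
  shows "(\<Sum>k\<in>I. w k * a k) < 0"
proof -
  have "w k * a k \<le> 0" if "k \<in> I" for k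
    using that assms by (simp add: mult_nonneg_nonpos order_less_imp_le)
  moreover have "\<exists>k\<in>I. w k * a k < 0"
    using assms by (metis mult_pos_neg order_le_less)
  ultimately show ?thesis
    using sum_strict_mono_ex1[of I "\<lambda>k. w k * a k" "\<lambda>_. 0"] assms(1) by simp
qed

text \<open>\<open>V\<close> is arbitrary in the induction because the hypothesis is applied both to
  \<open>V\<close> and to the kernel of \<open>L j\<close> in \<open>V\<close>.\<close>

lemma gordan_alternative:
  fixes L :: "'i \<Rightarrow> 'v::real_vector \<Rightarrow> real"
  assumes "finite I" and "subspace V" and "\<And>k. k \<in> I \<Longrightarrow> linear (L k)"
    and "\<not> (\<exists>v\<in>V. \<forall>k\<in>I. L k v < 0)"
  shows "\<exists>w. (\<forall>k\<in>I. w k \<ge> 0) \<and> (\<exists>k\<in>I. w k \<noteq> 0) \<and> (\<forall>v\<in>V. (\<Sum>k\<in>I. w k * L k v) = 0)"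
  using assms
proof (induction I arbitrary: V rule: finite_induct)
  case empty
  \<comment> \<open>For empty \<open>I\<close> the vector 0 satisfies the strict inequalities
    vacuously.\<close>
  then show ?case using subspace_0 by blast
next
  case (insert j I)
  note lin = insert.prems(2)
  \<comment> \<open>Every case below supplies weights \<open>w\<close> on \<open>I\<close> and a
    weight \<open>c\<close> for \<open>j\<close>; since \<open>j\<close> is not in \<open>I\<close>,
    they merge into one function.\<close>
  have extend: ?case
    if w: "\<forall>k\<in>I. w k \<ge> 0" "c \<ge> 0" "c \<noteq> 0 \<or> (\<exists>k\<in>I. w k \<noteq> 0)"
      and zero: "\<And>v. v \<in> V \<Longrightarrow> c * L j v + (\<Sum>k\<in>I. w k * L k v) = 0" for w c
  proof (intro exI[of _ "w(j := c)"] conjI ballI)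
    fix v assume "v \<in> V"
    have "(\<Sum>k\<in>I. (w(j := c)) k * L k v) = (\<Sum>k\<in>I. w k * L k v)"
      using insert.hyps by (intro sum.cong) auto
    then show "(\<Sum>k\<in>insert j I. (w(j := c)) k * L k v) = 0"
      using zero[OF \<open>v \<in> V\<close>] insert.hyps by simp
  qed (use w insert.hyps in auto)
  show ?case
  proof (cases "\<exists>v\<in>V. \<forall>k\<in>I. L k v < 0")
    case False
    then obtain w where w: "\<forall>k\<in>I. w k \<ge> 0" "\<exists>k\<in>I. w k \<noteq> 0"
      "\<forall>v\<in>V. (\<Sum>k\<in>I. w k * L k v) = 0"
      using insert.IH[OF insert.prems(1)] lin by blast
    show ?thesis by (rule extend[of w 0]) (use w in auto)
  next
    case True
    then obtain v0 where v0: "v0 \<in> V" "\<forall>k\<in>I. L k v0 < 0" by blast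
    \<comment> \<open>Otherwise \<open>v0\<close> would make all functionals on
      \<open>insert j I\<close> negative.\<close>
    then have Ljv0: "L j v0 \<ge> 0" using insert.prems(3) by force
    show ?thesis
    proof (cases "\<forall>v\<in>V. L j v = 0")
      case True
      show ?thesis by (rule extend[of "\<lambda>_. 0" 1]) (use True in auto)
    next
      case False
      then obtain u where u: "u \<in> V" "L j u \<noteq> 0" by blast
      define V' where "V' = {v\<in>V. L j v = 0}"
      interpret Lj: linear "L j" using lin by simp
      have sub: "subspace V'"
        using insert.prems(1)
        by (auto simp: V'_def subspace_def Lj.zero Lj.add Lj.scaleR)
      \<comment> \<open>A solution inside the kernel of \<open>L j\<close> could be moved slightly
        in a direction where \<open>L j\<close> is negative, and would then solve the full
        system.\<close>
      have "\<not> (\<exists>v\<in>V'. \<forall>k\<in>I. L k v < 0)"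
      proof
        assume "\<exists>v\<in>V'. \<forall>k\<in>I. L k v < 0"
        then obtain v where v: "v \<in> V" "L j v = 0" "\<forall>k\<in>I. L k v < 0"
          by (auto simp: V'_def)
        \<comment> \<open>This scaling gives \<open>L j u' = - (L j u)^2 < 0\<close> whatever the
          sign of \<open>L j u\<close>.\<close>
        define u' where "u' = (- L j u) *\<^sub>R u"
        have u': "u' \<in> V" "L j u' < 0"
          using u insert.prems(1)
          by (auto simp: u'_def subspace_scale subspace_neg Lj.scaleR Lj.neg zero_less_mult_iff)
        obtain e where e: "e > 0" "\<forall>k\<in>I. L k v + e * L k u' < 0"
          using exists_perturbation_negative[of I "\<lambda>k. L k v" "\<lambda>k. L k u'"] insert.hyps v by auto
        have "L k (v + e *\<^sub>R u') < 0" if "k \<in> insert j I" for k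
        proof -
          have "L k (v + e *\<^sub>R u') = L k v + e * L k u'"
            using lin[OF that] by (simp add: linear_add linear_scale)
          then show ?thesis using e v(2) u'(2) that by (auto simp: mult_pos_neg)
        qed
        moreover have "v + e *\<^sub>R u' \<in> V"
          using v u' insert.prems(1) by (simp add: subspace_add subspace_scale)
        ultimately show False using insert.prems(3) by blast
      qed
      then obtain w where w: "\<forall>k\<in>I. w k \<ge> 0" "\<exists>k\<in>I. w k \<noteq> 0"
        "\<forall>v\<in>V'. (\<Sum>k\<in>I. w k * L k v) = 0"
        using insert.IH[OF sub] lin by blast
      define G where "G v = (\<Sum>k\<in>I. w k * L k v)" for v
      have G_diff: "G (a - t *\<^sub>R b) = G a - t * G b" for a b t
        unfolding G_def sum_distrib_left sum_subtractf[symmetric]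
        using lin by (intro sum.cong) (auto simp: linear_diff linear_scale algebra_simps)
      define c where "c = G u / L j u"
      \<comment> \<open>Subtracting a multiple of \<open>u\<close> projects \<open>v\<close> into
        \<open>V'\<close>, where \<open>G\<close> vanishes; so \<open>G\<close> is a multiple of
        \<open>L j\<close> on \<open>V\<close>, with the factor read off at
        \<open>u\<close>.\<close>
      have G_eq: "G v = c * L j v" if "v \<in> V" for v
      proof -
        have "v - (L j v / L j u) *\<^sub>R u \<in> V'"
          using that u insert.prems(1)
          by (simp add: V'_def subspace_diff subspace_scale Lj.diff Lj.scaleR)
        then have "G (v - (L j v / L j u) *\<^sub>R u) = 0" using w(3) by (simp add: G_def)
        then show ?thesis using u(2) by (simp add: G_diff c_def field_simps)
      qed
      \<comment> \<open>Since \<open>G v0 = c * L j v0\<close> with \<open>L j v0 \<ge> 0\<close>,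
        this forces \<open>c < 0\<close>, so \<open>- c\<close> is an admissible weight for
        \<open>j\<close>.\<close>
      have "G v0 < 0"
        unfolding G_def by (rule sum_neg_weighted) (use w v0 insert.hyps in auto)
      then have "c < 0"
        using G_eq[OF v0(1)] Ljv0 by (simp add: mult_less_0_iff)
      show ?thesis
        by (rule extend[of w "- c"]) (use w \<open>c < 0\<close> G_eq in \<open>auto simp: G_def\<close>)
    qed
  qed
qed

lemma sum_fun_apply: "(\<Sum>k\<in>A. F k) t = (\<Sum>k\<in>A. F k t)"
  for F :: "'i \<Rightarrow> 'a \<Rightarrow> 'b::comm_monoid_add"
  by (induction A rule: infinite_finite_induct) auto

lemma kernel_combination_apply:
  assumes "t \<in> T"
  shows "(\<Sum>k\<in>A. c k *\<^sub>R kernel_section T K (h k)) t = (\<Sum>k\<in>A. c k * K t (h k))"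
  using assms by (simp add: sum_fun_apply scaleR_fun_def kernel_section_def)

lemma kernel_section_in_C_space:
  assumes "continuous_on (T \<times> T) (\<lambda>(s, t). K s t)" and "y \<in> T"
  shows "kernel_section T K y \<in> C_space T"
proof -
  have "continuous_on T (\<lambda>t. (\<lambda>(s, t). K s t) (t, y))"
    by (rule continuous_on_compose2[OF assms(1)]) (use assms(2) in \<open>auto intro!: continuous_intros\<close>)
  then have "continuous_on T (kernel_section T K y)"
    by (simp add: kernel_section_def cong: continuous_on_cong)
  then show ?thesis by (simp add: C_space_def kernel_section_def)
qed

lemma subspace_C_space: "subspace (C_space T)"
  by (auto simp: subspace_def C_space_def scaleR_fun_def plus_fun_def zero_fun_def
      intro!: continuous_intros)

lemma kernel_span_subset_C_space:
  assumes "continuous_on (T \<times> T) (\<lambda>(s, t). K s t)" and "Y \<subseteq> T"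
  shows "kernel_span T K Y \<subseteq> C_space T"
  unfolding kernel_span_def
  using assms kernel_section_in_C_space by (intro span_minimal subspace_C_space) blast

lemma linear_evaluation: "linear (\<lambda>v :: 'a \<Rightarrow> real. v t * s)"
  by (rule linearI) (auto simp: scaleR_fun_def algebra_simps)

text \<open>Evaluating a zero combination at each \<open>h i\<close> and pairing with
  \<open>c i\<close> gives the quadratic form of the kernel matrix, which is positive unless all
  coefficients vanish.\<close>

lemma kernel_combination_eq_0_iff:
  fixes h :: "nat \<Rightarrow> 'a"
  assumes "strictly_positive_definite T K" and "inj_on h {1..N}" and "h ` {1..N} \<subseteq> T"
  shows "(\<Sum>k=1..N. c k *\<^sub>R kernel_section T K (h k)) = 0 \<longleftrightarrow> (\<forall>k\<in>{1..N}. c k = 0)"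
proof (intro iffI)
  have spd: "positive_definite_matrix N (\<lambda>i j. K (h i) (h j))"
    using assms by (simp add: strictly_positive_definite_def)
  assume zero: "(\<Sum>k=1..N. c k *\<^sub>R kernel_section T K (h k)) = 0"
  have "(\<Sum>i=1..N. \<Sum>j=1..N. c i * K (h i) (h j) * c j) =
    (\<Sum>i=1..N. c i * (\<Sum>j=1..N. c j *\<^sub>R kernel_section T K (h j)) (h i))"
  proof (rule sum.cong)
    fix i assume "i \<in> {1..N}"
    then have "h i \<in> T" using assms(3) by auto
    then show "(\<Sum>j=1..N. c i * K (h i) (h j) * c j) =
        c i * (\<Sum>j=1..N. c j *\<^sub>R kernel_section T K (h j)) (h i)"
      by (simp add: kernel_combination_apply sum_distrib_left mult_ac)
  qed simp
  also have "\<dots> = 0" unfolding zero by simp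
  finally show "\<forall>k\<in>{1..N}. c k = 0"
    using spd by (auto simp: positive_definite_matrix_def)
qed (simp add: sum.neutral)

text \<open>By symmetry, the value of the combination at \<open>t\<close> is the functional applied
  to the section at \<open>t\<close>; for \<open>t\<close> in \<open>X\<close> these sections span
  \<open>kernel_span T K X\<close>.\<close>

lemma kernel_combination_vanishes_iff:
  assumes "symmetric_kernel T K" and "X \<subseteq> T" and "h ` I \<subseteq> T"
  shows "(\<forall>t\<in>X. (\<Sum>k\<in>I. c k *\<^sub>R kernel_section T K (h k)) t = 0) \<longleftrightarrow>
    (\<forall>v\<in>kernel_span T K X. (\<Sum>k\<in>I. c k * v (h k)) = 0)"
proof -
  have eq: "(\<Sum>k\<in>I. c k *\<^sub>R kernel_section T K (h k)) t =
      (\<Sum>k\<in>I. c k * kernel_section T K t (h k))" if "t \<in> X" for t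
  proof -
    have "K t (h k) = kernel_section T K t (h k)" if "k \<in> I" for k
      using assms \<open>t \<in> X\<close> that by (auto simp: symmetric_kernel_def kernel_section_def)
    then show ?thesis
      using assms(2) that by (subst kernel_combination_apply) auto
  qed
  have "(\<Sum>k\<in>I. c k * v (h k)) = 0"
    if "\<forall>t\<in>X. (\<Sum>k\<in>I. c k * kernel_section T K t (h k)) = 0" "v \<in> kernel_span T K X" for v
    using that(2) unfolding kernel_span_def
  proof (induction rule: span_induct)
    case base
    \<comment> \<open>The functions annihilated by the functional form a subspace.\<close>
    show ?case
      by (auto simp: subspace_def scaleR_fun_def distrib_left sum.distrib mult.left_commute
          simp flip: sum_distrib_left)
  next
    case (step y)
    then show ?case using that(1) by auto
  qed
  moreover have "kernel_section T K t \<in> kernel_span T K X" if "t \<in> X" for t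
    using that by (simp add: kernel_span_def span_base)
  ultimately show ?thesis using eq by auto
qed

theorem theorem4:
  fixes T :: "'a::topological_space set"
    and K :: "'a \<Rightarrow> 'a \<Rightarrow> real"
    and n N :: nat
    and x h :: "nat \<Rightarrow> 'a"
    and X H :: "'a set"
    and \<sigma> :: "'a \<Rightarrow> real"
  assumes "compact T"
    and "continuous_on (T \<times> T) (\<lambda>(s, t). K s t)"
    and "symmetric_kernel T K"
    and "strictly_positive_definite T K"
    and "X = x ` {1..n}" and "inj_on x {1..n}" and "X \<subseteq> T"
    and "H = h ` {1..N}" and "inj_on h {1..N}" and "H \<subseteq> T"
    and "\<sigma> ` H \<subseteq> {-1, 1}"
  shows "is_H_set T (kernel_span T K X) H \<sigma> \<longleftrightarrow>
    (\<exists>f \<in> kernel_span T K H.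
        f \<noteq> 0 \<and> (\<forall>t\<in>X. f t = 0) \<and>
        (\<exists>w :: nat \<Rightarrow> real. (\<forall>k\<in>{1..N}. w k \<ge> 0) \<and>
           f = (\<Sum>k=1..N. (w k * \<sigma> (h k)) *\<^sub>R kernel_section T K (h k))))"
proof -
  have sub: "h ` {1..N} \<subseteq> T" and \<sigma>: "\<And>k. k \<in> {1..N} \<Longrightarrow> \<sigma> (h k) \<noteq> 0"
    using assms(8,10,11) by force+
  let ?f = "\<lambda>w :: nat \<Rightarrow> real. \<Sum>k=1..N. (w k * \<sigma> (h k)) *\<^sub>R kernel_section T K (h k)"
  let ?neg = "\<lambda>v. \<forall>k\<in>{1..N}. v (h k) * \<sigma> (h k) < 0"
  have f_span: "?f w \<in> kernel_span T K H" for w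
    unfolding kernel_span_def assms(8) by (intro span_sum span_scale span_base) auto
  \<comment> \<open>Since \<open>\<sigma> (h k)\<close> is nonzero, a coefficient vanishes exactly
    when \<open>w k\<close> does.\<close>
  have f_nz: "?f w \<noteq> 0 \<longleftrightarrow> (\<exists>k\<in>{1..N}. w k \<noteq> 0)" for w
    using kernel_combination_eq_0_iff[OF assms(4,9) sub] \<sigma> by simp
  have f_X: "(\<forall>t\<in>X. ?f w t = 0) \<longleftrightarrow>
      (\<forall>v\<in>kernel_span T K X. (\<Sum>k=1..N. w k * (v (h k) * \<sigma> (h k))) = 0)" for w
    using kernel_combination_vanishes_iff[OF assms(3,7) sub, of "\<lambda>k. w k * \<sigma> (h k)"]
    by (simp add: mult_ac)
  have V: "subspace (kernel_span T K X)"
    by (simp add: kernel_span_def)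
  have "is_H_set T (kernel_span T K X) H \<sigma> \<longleftrightarrow> \<not> (\<exists>v\<in>kernel_span T K X. ?neg v)"
    using V kernel_span_subset_C_space[OF assms(2,7)] assms(8,10,11)
    by (simp add: is_H_set_def)
  also have "\<dots> \<longleftrightarrow> (\<exists>w. (\<forall>k\<in>{1..N}. w k \<ge> 0) \<and> (\<exists>k\<in>{1..N}. w k \<noteq> 0) \<and>
      (\<forall>v\<in>kernel_span T K X. (\<Sum>k=1..N. w k * (v (h k) * \<sigma> (h k))) = 0))"
  proof (intro iffI)
    assume "\<not> (\<exists>v\<in>kernel_span T K X. ?neg v)"
    then show "\<exists>w. (\<forall>k\<in>{1..N}. w k \<ge> 0) \<and> (\<exists>k\<in>{1..N}. w k \<noteq> 0) \<and>
        (\<forall>v\<in>kernel_span T K X. (\<Sum>k=1..N. w k * (v (h k) * \<sigma> (h k))) = 0)"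
      \<comment> \<open>The functionals are
        \<open>v \<mapsto> v (h k) * \<sigma> (h k)\<close>.\<close>
      by (intro gordan_alternative[OF _ V]) (auto intro: linear_evaluation)
  next
    assume "\<exists>w. (\<forall>k\<in>{1..N}. w k \<ge> 0) \<and> (\<exists>k\<in>{1..N}. w k \<noteq> 0) \<and>
        (\<forall>v\<in>kernel_span T K X. (\<Sum>k=1..N. w k * (v (h k) * \<sigma> (h k))) = 0)"
    then obtain w j where w: "\<forall>k\<in>{1..N}. w k \<ge> 0" "j \<in> {1..N}" "w j \<noteq> 0"
      "\<And>v. v \<in> kernel_span T K X \<Longrightarrow> (\<Sum>k=1..N. w k * (v (h k) * \<sigma> (h k))) = 0"
      by blast
    show "\<not> (\<exists>v\<in>kernel_span T K X. ?neg v)"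
    proof
      assume "\<exists>v\<in>kernel_span T K X. ?neg v"
      then obtain v where v: "v \<in> kernel_span T K X" "?neg v" by blast
      \<comment> \<open>Negativity of \<open>v\<close> against every sign contradicts the vanishing
        of the weighted sum on the span.\<close>
      have "(\<Sum>k=1..N. w k * (v (h k) * \<sigma> (h k))) < 0"
        by (rule sum_neg_weighted) (use w v in auto)
      then show False using w(4)[OF v(1)] by simp
    qed
  qed
  also have "\<dots> \<longleftrightarrow> (\<exists>f \<in> kernel_span T K H. f \<noteq> 0 \<and> (\<forall>t\<in>X. f t = 0) \<and>
        (\<exists>w. (\<forall>k\<in>{1..N}. w k \<ge> 0) \<and> f = ?f w))"
    unfolding f_nz[symmetric] f_X[symmetric] using f_span by blast
  finally show ?thesis .
qed

end
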